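(* Let $\mu$ be a measure on $\mathbb{R}$ and $x_0\in\mathbb{R}$. Then $x_0$ is a $\sigma$-point of $\mu$ if and only if $\mu$ has a strong derivative at $x_0$. Moreover, in this case $D_\sigma\mu(x_0)=D\mu(x_0)$.
   Context: $m$ is Lebesgue measure on $\mathbb{R}$, and $B(x,r)=(x-r,x+r)$. "Measure" means a complex or signed Borel measure $\mu$ on $\mathbb{R}$ whose total variation $|\mu|$ is finite on compact sets (only bounded Borel sets are evaluated below). $\sigma$-point: $x_0$ is a $\sigma$-point of $\mu$ if there is $L\in\mathbb{C}$ such that for each $\epsilon>0$ there is $\delta>0$ with $|\mu(B(x,r))-L\,m(B(x,r))|<\epsilon(|x-x_0|+r)$ whenever $|x-x_0|<\delta$ and $0<r<\delta$; then $D_\sigma\mu(x_0)=L$. Strong derivative: $\mu$ has strong derivative $L\in\mathbb{C}$ at $x_0$, written $D\mu(x_0)=L$, if $\lim_{r\to0^+}\frac{\mu(x_0+rB)}{m(rB)}=L$ for every bounded nonempty open interval $B\subset\mathbb{R}$ (arbitrary center and radius), where $rB=\{rx: x\in B\}$. *)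

theory Defs
  imports "HOL-Analysis.Analysis"
begin

text \<open>
  A locally finite complex measure on \<open>\<real>\<close> is represented by a set function of which only the
  values on bounded Borel sets are relevant. Signed measures are the real-valued case: finiteness
  of the total variation on compact sets forces their values on bounded sets to be finite.
\<close>

definition total_variation :: "(real set \<Rightarrow> complex) \<Rightarrow> real set \<Rightarrow> ennreal" where
  "total_variation \<mu> E =
     (SUP A \<in> {A :: nat \<Rightarrow> real set. range A \<subseteq> sets borel \<and> disjoint_family A \<and> (\<Union>n. A n) = E}.
        \<Sum>n. ennreal (cmod (\<mu> (A n))))"

definition locally_finite_measure :: "(real set \<Rightarrow> complex) \<Rightarrow> bool" where
  "locally_finite_measure \<mu> \<longleftrightarrow>
     \<mu> {} = 0 \<and>
     (\<forall>A :: nat \<Rightarrow> real set.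
        range A \<subseteq> sets borel \<longrightarrow> disjoint_family A \<longrightarrow> bounded (\<Union>n. A n) \<longrightarrow>
        (\<lambda>n. \<mu> (A n)) sums \<mu> (\<Union>n. A n)) \<and>
     (\<forall>K. compact K \<longrightarrow> total_variation \<mu> K < \<infinity>)"

definition has_sigma_derivative :: "(real set \<Rightarrow> complex) \<Rightarrow> real \<Rightarrow> complex \<Rightarrow> bool" where
  "has_sigma_derivative \<mu> x0 L \<longleftrightarrow>
     (\<forall>\<epsilon>>0. \<exists>\<delta>>0. \<forall>x r. \<bar>x - x0\<bar> < \<delta> \<longrightarrow> 0 < r \<longrightarrow> r < \<delta> \<longrightarrow>
        cmod (\<mu> (ball x r) - L * of_real (measure lborel (ball x r))) < \<epsilon> * (\<bar>x - x0\<bar> + r))"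

definition sigma_point :: "(real set \<Rightarrow> complex) \<Rightarrow> real \<Rightarrow> bool" where
  "sigma_point \<mu> x0 \<longleftrightarrow> (\<exists>L. has_sigma_derivative \<mu> x0 L)"

definition sigma_derivative :: "(real set \<Rightarrow> complex) \<Rightarrow> real \<Rightarrow> complex" where
  "sigma_derivative \<mu> x0 = (THE L. has_sigma_derivative \<mu> x0 L)"

text \<open>On the real line the bounded nonempty open intervals are exactly the balls of positive radius.\<close>

definition has_strong_derivative :: "(real set \<Rightarrow> complex) \<Rightarrow> real \<Rightarrow> complex \<Rightarrow> bool" where
  "has_strong_derivative \<mu> x0 L \<longleftrightarrow>
     (\<forall>c s. 0 < s \<longrightarrow>
        ((\<lambda>r. \<mu> ((+) x0 ` (*) r ` ball c s) / of_real (measure lborel ((*) r ` ball c s)))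
           \<longlongrightarrow> L) (at_right 0))"

definition strongly_differentiable :: "(real set \<Rightarrow> complex) \<Rightarrow> real \<Rightarrow> bool" where
  "strongly_differentiable \<mu> x0 \<longleftrightarrow> (\<exists>L. has_strong_derivative \<mu> x0 L)"

definition strong_derivative :: "(real set \<Rightarrow> complex) \<Rightarrow> real \<Rightarrow> complex" where
  "strong_derivative \<mu> x0 = (THE L. has_strong_derivative \<mu> x0 L)"

text \<open>Both descriptions are well-defined.\<close>

lemma has_sigma_derivative_unique:
  assumes "has_sigma_derivative \<mu> x0 L" "has_sigma_derivative \<mu> x0 L'"
  shows "L = L'"
proof (rule ccontr)
  assume "L \<noteq> L'"
  define e where "e = cmod (L - L')"
  have e: "e > 0" using \<open>L \<noteq> L'\<close> by (simp add: e_def)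
  obtain d where d: "d > 0" "\<And>x r. \<bar>x - x0\<bar> < d \<Longrightarrow> 0 < r \<Longrightarrow> r < d \<Longrightarrow>
      cmod (\<mu> (ball x r) - L * of_real (measure lborel (ball x r))) < e * (\<bar>x - x0\<bar> + r)"
    using assms(1) e unfolding has_sigma_derivative_def by metis
  obtain d' where d': "d' > 0" "\<And>x r. \<bar>x - x0\<bar> < d' \<Longrightarrow> 0 < r \<Longrightarrow> r < d' \<Longrightarrow>
      cmod (\<mu> (ball x r) - L' * of_real (measure lborel (ball x r))) < e * (\<bar>x - x0\<bar> + r)"
    using assms(2) e unfolding has_sigma_derivative_def by metis
  define r where "r = min d d' / 2"
  have r: "0 < r" "r < d" "r < d'" using d(1) d'(1) by (auto simp: r_def)
  let ?m = "measure lborel (ball x0 r)"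
  have m: "?m = 2 * r" using r(1) by (simp add: ball_eq_greaterThanLessThan)
  have "cmod ((L - L') * of_real ?m) =
      cmod ((\<mu> (ball x0 r) - L' * of_real ?m) - (\<mu> (ball x0 r) - L * of_real ?m))"
    by (simp add: algebra_simps)
  also have "\<dots> \<le> cmod (\<mu> (ball x0 r) - L' * of_real ?m) + cmod (\<mu> (ball x0 r) - L * of_real ?m)"
    by (rule norm_triangle_ineq4)
  also have "\<dots> < e * r + e * r"
    using d(2)[of x0 r] d'(2)[of x0 r] r d(1) d'(1) by simp
  finally have "cmod ((L - L') * of_real ?m) < e * r + e * r" .
  moreover have "cmod ((L - L') * of_real ?m) = e * (2 * r)"
    using r(1) unfolding m norm_mult e_def norm_of_real by simp
  ultimately show False by simp
qed

lemma has_strong_derivative_unique: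
  assumes "has_strong_derivative \<mu> x0 L" "has_strong_derivative \<mu> x0 L'"
  shows "L = L'"
  using assms tendsto_unique[OF trivial_limit_at_right_real]
  unfolding has_strong_derivative_def by (meson zero_less_one)

end

theory Submission imports Defs begin

text \<open>
  Subtracting \<open>L\<close> times Lebesgue measure reduces the problem to \<open>L = 0\<close>. Dividing the
  \<open>\<sigma>\<close>-estimate by the length of the interval gives the strong derivative. Conversely, applying the
  strong derivative to \<open>(0, 1)\<close>, \<open>(-1, 0)\<close> and \<open>(-1, 1)\<close> gives \<open>\<nu>(I) = o(r)\<close> for the intervals
  \<open>(x\<^sub>0, x\<^sub>0 + r)\<close>, \<open>(x\<^sub>0 - r, x\<^sub>0)\<close> and \<open>(x\<^sub>0 - r, x\<^sub>0 + r)\<close>. Every interval contained in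
  \<open>(x\<^sub>0 - r, x\<^sub>0 + r)\<close> is obtained from intervals with endpoint \<open>x\<^sub>0\<close> by a bounded number of
  additions and subtractions, up to a limit at one endpoint, which yields uniformity in the centre.
\<close>

section \<open>Set functions that are countably additive on bounded Borel sets\<close>

locale bounded_countably_additive =
  fixes \<nu> :: "real set \<Rightarrow> complex"
  assumes empty: "\<nu> {} = 0"
    and countably_additive: "\<And>A :: nat \<Rightarrow> real set.
      range A \<subseteq> sets borel \<Longrightarrow> disjoint_family A \<Longrightarrow> bounded (\<Union>n. A n) \<Longrightarrow>
      (\<lambda>n. \<nu> (A n)) sums \<nu> (\<Union>n. A n)"
begin

lemma additive:
  assumes "A \<in> sets borel" "B \<in> sets borel" "A \<inter> B = {}" "bounded (A \<union> B)"
  shows "\<nu> (A \<union> B) = \<nu> A + \<nu> B"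
proof -
  have un: "(\<Union>n. binaryset A B n) = A \<union> B"
    by (rule UN_binaryset_eq)
  have "(\<lambda>n. \<nu> (binaryset A B n)) sums \<nu> (\<Union>n. binaryset A B n)"
    using assms un
    by (intro countably_additive) (auto simp: range_binaryset_eq disjoint_family_on_def binaryset_def)
  moreover have "(\<lambda>n. \<nu> (binaryset A B n)) sums (\<nu> A + \<nu> B)"
    by (rule binaryset_sums) (rule empty)
  ultimately show ?thesis
    unfolding un by (rule sums_unique2)
qed

lemma greaterThanLessThan_split:
  assumes "a < c" "c < b"
  shows "\<nu> {a<..<b} = \<nu> {a<..<c} + \<nu> {c..<b}"
proof -
  have eq: "{a<..<b} = {a<..<c} \<union> {c..<b}"
    using assms by auto
  show ?thesis
    unfolding eq by (rule additive) auto
qed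

lemma atLeastLessThan_split:
  assumes "a \<le> c" "c \<le> b"
  shows "\<nu> {a..<b} = \<nu> {a..<c} + \<nu> {c..<b}"
proof -
  have eq: "{a..<b} = {a..<c} \<union> {c..<b}"
    using assms by auto
  show ?thesis
    unfolding eq by (rule additive) auto
qed

text \<open>Continuity from below: \<open>{c..<b}\<close> increases to \<open>{a<..<b}\<close> as
  \<open>c\<close> decreases to \<open>a\<close>. This bridges the gap between the half-open
  intervals produced by subtraction and the open ones in the definitions.\<close>

lemma norm_greaterThanLessThan_le:
  assumes "a < b" and C: "\<And>c. a < c \<Longrightarrow> c < b \<Longrightarrow> cmod (\<nu> {c..<b}) \<le> C"
  shows "cmod (\<nu> {a<..<b}) \<le> C"
proof -
  \<comment> \<open>Decreases strictly from \<open>u 0 = b\<close> to the limit \<open>a\<close>, so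
    consecutive terms cut \<open>{a<..<b}\<close> into disjoint half-open pieces.\<close>
  define u where "u n = a + (b - a) / real (Suc n)" for n
  have u0: "u 0 = b" by (simp add: u_def)
  have u_gt: "a < u n" for n using \<open>a < b\<close> by (simp add: u_def)
  have u_less: "u (Suc n) < u n" for n
    using \<open>a < b\<close> unfolding u_def by (intro add_strict_left_mono divide_strict_left_mono) auto
  have u_anti: "u n \<le> u m" if "m \<le> n" for m n
    by (rule lift_Suc_antimono_le[OF _ that]) (rule less_imp_le[OF u_less])
  have u_lim: "u \<longlonglongrightarrow> a"
    using tendsto_add[OF tendsto_const LIMSEQ_Suc[OF lim_const_over_n], of a "b - a"]
    unfolding u_def by simp
  define A where "A n = {u (Suc n)..<u n}" for n
  have un: "(\<Union>n. A n) = {a<..<b}"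
  proof (intro equalityI subsetI)
    fix x assume "x \<in> (\<Union>n. A n)"
    then obtain n where "x \<in> {u (Suc n)..<u n}" by (auto simp: A_def)
    then show "x \<in> {a<..<b}"
      using u_gt[of "Suc n"] u_anti[of 0 n] u0 by auto
  next
    fix x assume x: "x \<in> {a<..<b}"
    then have "\<exists>n. u n \<le> x"
      using order_tendstoD(2)[OF u_lim, of x]
      by (auto simp: eventually_sequentially intro: less_imp_le)
    \<comment> \<open>The least such index is nonzero because \<open>x < b = u 0\<close>; its
      predecessor is the index of the piece containing \<open>x\<close>.\<close>
    then obtain n where n: "u n \<le> x" "\<And>m. m < n \<Longrightarrow> \<not> u m \<le> x"
      using exists_least_iff[of "\<lambda>n. u n \<le> x"] by blast
    with x u0 obtain m where m: "n = Suc m" by (cases n) auto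
    have "x < u m" using n(2)[of m] unfolding m not_le by blast
    then have "x \<in> A m" using n(1) by (simp add: A_def m)
    then show "x \<in> (\<Union>n. A n)" by blast
  qed
  have disj: "disjoint_family A"
  proof -
    have "A m \<inter> A n = {}" if "m < n" for m n
      using u_anti[of "Suc m" n] that by (auto simp: A_def)
    then show ?thesis
      by (auto simp: disjoint_family_on_def) (metis disjoint_iff linorder_neqE_nat)
  qed
  have partial: "(\<Sum>i<n. \<nu> (A i)) = \<nu> {u n..<b}" for n
  proof (induction n)
    case 0
    then show ?case by (simp add: u0 empty)
  next
    case (Suc n)
    then show ?case
      using atLeastLessThan_split[of "u (Suc n)" "u n" b] u_less[of n] u_anti[of 0 n] u0
      by (simp add: A_def)
  qed
  have "range A \<subseteq> sets borel" by (auto simp: A_def)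
  then have "(\<lambda>n. \<nu> (A n)) sums \<nu> (\<Union>n. A n)"
    using disj by (rule countably_additive) (simp add: un)
  then have "(\<lambda>n. \<nu> {u n..<b}) \<longlonglongrightarrow> \<nu> {a<..<b}"
    by (simp add: sums_def partial un)
  \<comment> \<open>The shift drops index 0, where \<open>u 0 = b\<close> violates the condition
    \<open>c < b\<close> of the bound.\<close>
  then have lim: "(\<lambda>n. cmod (\<nu> {u (Suc n)..<b})) \<longlonglongrightarrow> cmod (\<nu> {a<..<b})"
    by (rule tendsto_norm[OF LIMSEQ_Suc])
  show ?thesis
  proof (rule Lim_bounded[OF lim], intro allI impI)
    show "cmod (\<nu> {u (Suc n)..<b}) \<le> C" for n
      using u_gt u_less[of n] u_anti[of 0 n] u0 by (intro C) auto
  qed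
qed

text \<open>For \<open>a < c < b\<close>, \<open>{c..<b}\<close> is the difference of two open
  intervals starting at \<open>x0\<close>, each contributing at most \<open>e * (b - x0)\<close>;
  hence the factor 2. Even when \<open>a = x0\<close>, the smaller of them has positive length since
  \<open>c > a\<close>.\<close>

lemma norm_le_right_of:
  assumes bound: "\<And>t. 0 < t \<Longrightarrow> t < d \<Longrightarrow> cmod (\<nu> {x0<..<x0 + t}) \<le> e * t"
    and "0 \<le> e" "x0 \<le> a" "a < b" "b < x0 + d"
  shows "cmod (\<nu> {a<..<b}) \<le> 2 * e * (b - x0)"
proof (rule norm_greaterThanLessThan_le[OF \<open>a < b\<close>])
  fix c assume c: "a < c" "c < b"
  have "\<nu> {c..<b} = \<nu> {x0<..<b} - \<nu> {x0<..<c}"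
    using greaterThanLessThan_split[of x0 c b] c assms by simp
  also have "cmod \<dots> \<le> cmod (\<nu> {x0<..<b}) + cmod (\<nu> {x0<..<c})"
    by (rule norm_triangle_ineq4)
  also have "\<dots> \<le> e * (b - x0) + e * (c - x0)"
    using bound[of "b - x0"] bound[of "c - x0"] c assms by (intro add_mono) auto
  also have "\<dots> \<le> e * (b - x0) + e * (b - x0)"
    using c \<open>0 \<le> e\<close> by (intro add_mono mult_left_mono) auto
  finally show "cmod (\<nu> {c..<b}) \<le> 2 * e * (b - x0)" by simp
qed

text \<open>Allows estimates to the left of \<open>x0\<close> to be read off from those to the right
  of \<open>- x0\<close>.\<close>

lemma reflect: "bounded_countably_additive (\<lambda>A. \<nu> (uminus ` A))"
proof
  show "\<nu> (uminus ` {}) = 0" by (simp add: empty)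
next
  fix A :: "nat \<Rightarrow> real set"
  assume A: "range A \<subseteq> sets borel" "disjoint_family A" "bounded (\<Union>n. A n)"
  have un: "uminus ` (\<Union>n. A n) = (\<Union>n. uminus ` A n)"
    by (rule image_UN)
  have "uminus ` B \<in> sets borel" if "B \<in> sets borel" for B :: "real set"
  proof -
    \<comment> \<open>Negation is an involution, so the image is a preimage under a Borel
      function.\<close>
    have "uminus ` B = uminus -` B \<inter> space borel"
      by (auto intro: image_eqI[of x uminus "- x" for x])
    also have "\<dots> \<in> sets borel"
      using that by (intro measurable_sets[of uminus borel borel]) auto
    finally show ?thesis .
  qed
  with A have "range (\<lambda>n. uminus ` A n) \<subseteq> sets borel" by auto
  moreover have "disjoint_family (\<lambda>n. uminus ` A n)"
    using A(2) by (fastforce simp: disjoint_family_on_def)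
  moreover have "bounded (\<Union>n. uminus ` A n)"
    using A(3) unfolding un[symmetric] by simp
  ultimately show "(\<lambda>n. \<nu> (uminus ` A n)) sums \<nu> (uminus ` (\<Union>n. A n))"
    unfolding un by (rule countably_additive)
qed

lemma norm_le_left_of:
  assumes bound: "\<And>t. 0 < t \<Longrightarrow> t < d \<Longrightarrow> cmod (\<nu> {x0 - t<..<x0}) \<le> e * t"
    and "0 \<le> e" "b \<le> x0" "a < b" "x0 - d < a"
  shows "cmod (\<nu> {a<..<b}) \<le> 2 * e * (x0 - a)"
proof -
  interpret r: bounded_countably_additive "\<lambda>A. \<nu> (uminus ` A)" by (rule reflect)
  have image: "uminus ` {- q<..<- p} = {p<..<q}" for p q :: real by simp
  have "cmod (\<nu> (uminus ` {- b<..<- a})) \<le> 2 * e * (- a - - x0)"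
  proof (rule r.norm_le_right_of)
    fix t assume "0 < t" "t < d"
    then have "cmod (\<nu> (uminus ` {- x0<..<- (x0 - t)})) \<le> e * t"
      unfolding image by (rule bound)
    then show "cmod (\<nu> (uminus ` {- x0<..<- x0 + t})) \<le> e * t"
      by (simp only: minus_diff_eq uminus_add_conv_diff)
  qed (use assms(2-) in linarith)+
  then show ?thesis
    unfolding image by (simp only: diff_minus_eq_add uminus_add_conv_diff)
qed

text \<open>If \<open>x0\<close> lies inside the interval, the two sides and the point mass at
  \<open>x0\<close> contribute at most \<open>e * M\<close>, \<open>e * M\<close> and
  \<open>3 * e * M\<close>, where \<open>M\<close> is \<open>\<bar>x - x0\<bar> + r\<close>; hence
  the 5. Otherwise a one-sided estimate gives the factor 2.\<close>

lemma norm_ball_le: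
  assumes right: "\<And>t. 0 < t \<Longrightarrow> t < d \<Longrightarrow> cmod (\<nu> {x0<..<x0 + t}) \<le> e * t"
    and left: "\<And>t. 0 < t \<Longrightarrow> t < d \<Longrightarrow> cmod (\<nu> {x0 - t<..<x0}) \<le> e * t"
    and centred: "\<And>t. 0 < t \<Longrightarrow> t < d \<Longrightarrow> cmod (\<nu> {x0 - t<..<x0 + t}) \<le> e * t"
    and "0 \<le> e" "0 < r" "\<bar>x - x0\<bar> + r < d"
  shows "cmod (\<nu> (ball x r)) \<le> 5 * e * (\<bar>x - x0\<bar> + r)"
proof -
  define M where "M = \<bar>x - x0\<bar> + r"
  define a where "a = x - r"
  define b where "b = x + r"
  have M: "b - x0 \<le> M" "x0 - a \<le> M" "M < d" "0 < M"
    using assms by (auto simp: a_def b_def M_def)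
  have "a < b" using \<open>0 < r\<close> by (simp add: a_def b_def)
  have le5: "k * e * t \<le> 5 * e * M" if "t \<le> M" "0 \<le> k" "k \<le> 5" for k t
  proof -
    have "k * e * t \<le> k * e * M" using that \<open>0 \<le> e\<close> by (intro mult_left_mono) auto
    also have "\<dots> \<le> 5 * e * M" using that \<open>0 \<le> e\<close> M by (intro mult_right_mono) auto
    finally show ?thesis .
  qed
  consider "x0 \<le> a" | "b \<le> x0" | "a < x0" "x0 < b" by linarith
  then have "cmod (\<nu> {a<..<b}) \<le> 5 * e * M"
  proof cases
    case 1
    have "cmod (\<nu> {a<..<b}) \<le> 2 * e * (b - x0)"
      using norm_le_right_of[OF right] 1 M \<open>a < b\<close> \<open>0 \<le> e\<close> by simp
    then show ?thesis using le5[of "b - x0" 2] M by simp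
  next
    case 2
    have "cmod (\<nu> {a<..<b}) \<le> 2 * e * (x0 - a)"
      using norm_le_left_of[OF left] 2 M \<open>a < b\<close> \<open>0 \<le> e\<close> by simp
    then show ?thesis using le5[of "x0 - a" 2] M by simp
  next
    case 3
    have split: "\<nu> {p<..<q} = \<nu> {p<..<x0} + \<nu> {x0} + \<nu> {x0<..<q}" if "p < x0" "x0 < q" for p q
    proof -
      have eq: "{x0..<q} = {x0} \<union> {x0<..<q}" using that by auto
      have "\<nu> {x0..<q} = \<nu> {x0} + \<nu> {x0<..<q}"
        unfolding eq by (rule additive) auto
      then show ?thesis using greaterThanLessThan_split[OF that] by simp
    qed
    have R: "cmod (\<nu> {x0<..<b}) \<le> e * (b - x0)"
      using right[of "b - x0"] 3 M by simp
    have L: "cmod (\<nu> {a<..<x0}) \<le> e * (x0 - a)"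
      using left[of "x0 - a"] 3 M by simp
    \<comment> \<open>The one-sided open intervals miss \<open>x0\<close>; the centred interval is
      what controls a possible atom there.\<close>
    have "\<nu> {x0} = \<nu> {x0 - M<..<x0 + M} - \<nu> {x0 - M<..<x0} - \<nu> {x0<..<x0 + M}"
      using split[of "x0 - M" "x0 + M"] M by simp
    then have "cmod (\<nu> {x0}) \<le> cmod (\<nu> {x0 - M<..<x0 + M}) + cmod (\<nu> {x0 - M<..<x0})
        + cmod (\<nu> {x0<..<x0 + M})"
      by (simp only:) (rule order_trans[OF norm_triangle_ineq4 add_right_mono[OF norm_triangle_ineq4]])
    then have C: "cmod (\<nu> {x0}) \<le> 3 * (e * M)"
      using right[of M] left[of M] centred[of M] M by simp
    have "cmod (\<nu> {a<..<b}) \<le> cmod (\<nu> {a<..<x0}) + cmod (\<nu> {x0}) + cmod (\<nu> {x0<..<b})"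
      unfolding split[OF 3] by (rule order_trans[OF norm_triangle_ineq add_right_mono[OF norm_triangle_ineq]])
    moreover have "e * (b - x0) \<le> e * M" "e * (x0 - a) \<le> e * M"
      using M \<open>0 \<le> e\<close> by (auto intro: mult_left_mono)
    ultimately show ?thesis using R L C by simp
  qed
  then show ?thesis
    by (simp add: M_def a_def b_def ball_eq_greaterThanLessThan)
qed

end

section \<open>Reduction to derivative zero and the strong derivative in epsilon-delta form\<close>

lemma bounded_countably_additive_minus_lborel:
  assumes "locally_finite_measure \<mu>"
  shows "bounded_countably_additive (\<lambda>A. \<mu> A - L * of_real (measure lborel A))"
proof
  show "\<mu> {} - L * of_real (measure lborel {}) = 0"
    using assms by (simp add: locally_finite_measure_def)
next
  fix A :: "nat \<Rightarrow> real set"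
  assume A: "range A \<subseteq> sets borel" "disjoint_family A" "bounded (\<Union>n. A n)"
  have "(\<lambda>n. measure lborel (A n)) sums measure lborel (\<Union>n. A n)"
    \<comment> \<open>Boundedness keeps the Lebesgue measure finite; \<open>measure\<close> would
      turn an infinite value into 0.\<close>
    using A emeasure_bounded_finite[OF A(3)] by (intro measure_UNION) auto
  then have "(\<lambda>n. L * of_real (measure lborel (A n))) sums (L * of_real (measure lborel (\<Union>n. A n)))"
    by (intro sums_mult sums_of_real)
  moreover have "(\<lambda>n. \<mu> (A n)) sums \<mu> (\<Union>n. A n)"
    using assms A by (simp add: locally_finite_measure_def)
  ultimately show "(\<lambda>n. \<mu> (A n) - L * of_real (measure lborel (A n))) sums
      (\<mu> (\<Union>n. A n) - L * of_real (measure lborel (\<Union>n. A n)))"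
    by (intro sums_diff)
qed

lemma measure_lborel_ball: "0 \<le> r \<Longrightarrow> measure lborel (ball x r) = 2 * r" for x r :: real
  by (simp add: ball_eq_greaterThanLessThan)

lemma scaled_ball: "0 < r \<Longrightarrow> (*) r ` ball c s = ball (r * c) (r * s)" for c s r :: real
  using ball_scale[of r c s] by simp

text \<open>The scaled interval has length \<open>2 * r * s\<close>. Clearing this denominator
  leaves a bound linear in \<open>r\<close>, and the fixed factor \<open>2 * s\<close> is absorbed
  into \<open>e\<close>.\<close>

lemma has_strong_derivative_iff:
  "has_strong_derivative \<mu> x0 L \<longleftrightarrow>
     (\<forall>c s e. 0 < s \<longrightarrow> 0 < e \<longrightarrow> (\<exists>d>0. \<forall>r. 0 < r \<longrightarrow> r < d \<longrightarrow>
        cmod (\<mu> (ball (x0 + r * c) (r * s)) - L * of_real (measure lborel (ball (x0 + r * c) (r * s))))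
          < e * r))"
proof -
  let ?q = "\<lambda>c s r. \<mu> ((+) x0 ` (*) r ` ball c s) / of_real (measure lborel ((*) r ` ball c s))"
  let ?\<nu> = "\<lambda>c s r. \<mu> (ball (x0 + r * c) (r * s)) -
    L * of_real (measure lborel (ball (x0 + r * c) (r * s)))"
  have dist_less: "dist (?q c s r) L < e \<longleftrightarrow> cmod (?\<nu> c s r) < e * (2 * s) * r"
    if "0 < r" "0 < s" for c s r e
  proof -
    have "?q c s r - L = ?\<nu> c s r / of_real (2 * r * s)"
      unfolding scaled_ball[OF \<open>0 < r\<close>] image_add_ball using that
      by (simp add: measure_lborel_ball field_simps)
    then have "dist (?q c s r) L = cmod (?\<nu> c s r) / (2 * r * s)"
      using that by (simp only: dist_norm norm_divide norm_of_real) simp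
    then show ?thesis using that by (simp add: pos_divide_less_eq ac_simps del: image_add_ball)
  qed
  have "(?q c s \<longlongrightarrow> L) (at_right 0) \<longleftrightarrow>
      (\<forall>e>0. \<exists>d>0. \<forall>r. 0 < r \<longrightarrow> r < d \<longrightarrow> cmod (?\<nu> c s r) < e * r)" (is "?l \<longleftrightarrow> ?r")
    if "0 < s" for c s
  proof -
    have iff: "?l \<longleftrightarrow> (\<forall>e>0. \<exists>d>0. \<forall>r. 0 < r \<longrightarrow> r < d \<longrightarrow> cmod (?\<nu> c s r) < e * (2 * s) * r)"
      unfolding tendsto_iff eventually_at_right_field
      by (simp only: dist_less[OF _ that] cong: imp_cong)
    show ?thesis
    proof
      assume ?l
      show ?r
      proof (intro allI impI)
        fix e :: real assume "0 < e"
        then show "\<exists>d>0. \<forall>r. 0 < r \<longrightarrow> r < d \<longrightarrow> cmod (?\<nu> c s r) < e * r"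
          using \<open>?l\<close>[unfolded iff, rule_format, of "e / (2 * s)"] that by simp
      qed
    next
      assume ?r
      then show ?l unfolding iff using that by simp
    qed
  qed
  then show ?thesis unfolding has_strong_derivative_def by blast
qed

section \<open>The two implications\<close>

lemma has_sigma_derivative_imp_has_strong_derivative:
  assumes "has_sigma_derivative \<mu> x0 L"
  shows "has_strong_derivative \<mu> x0 L"
  unfolding has_strong_derivative_iff
proof (intro allI impI)
  fix c s e :: real assume s: "0 < s" and e: "0 < e"
  \<comment> \<open>For centre \<open>x0 + r * c\<close> and radius \<open>r * s\<close>, distance
    to \<open>x0\<close> plus radius is at most \<open>r * K\<close>, in fact equal to it. Hence the
    tolerance \<open>e / K\<close> and the threshold \<open>d / K\<close>.\<close>
  define K where "K = \<bar>c\<bar> + s"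
  have K: "0 < K" using s by (simp add: K_def)
  obtain d where d: "0 < d" "\<And>x r. \<bar>x - x0\<bar> < d \<Longrightarrow> 0 < r \<Longrightarrow> r < d \<Longrightarrow>
      cmod (\<mu> (ball x r) - L * of_real (measure lborel (ball x r))) < e / K * (\<bar>x - x0\<bar> + r)"
    using assms e K unfolding has_sigma_derivative_def by (metis divide_pos_pos)
  show "\<exists>d>0. \<forall>r. 0 < r \<longrightarrow> r < d \<longrightarrow>
      cmod (\<mu> (ball (x0 + r * c) (r * s)) - L * of_real (measure lborel (ball (x0 + r * c) (r * s))))
        < e * r"
  proof (intro exI[of _ "d / K"] conjI allI impI)
    show "0 < d / K" using d K by simp
    fix r assume r: "0 < r" "r < d / K"
    then have "r * \<bar>c\<bar> + r * s < d" using K by (simp add: K_def field_simps)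
    moreover have "0 \<le> r * \<bar>c\<bar>" "0 < r * s" using r s by auto
    ultimately have "r * \<bar>c\<bar> < d" "r * s < d" "0 < r * s" by linarith+
    then have "cmod (\<mu> (ball (x0 + r * c) (r * s)) -
        L * of_real (measure lborel (ball (x0 + r * c) (r * s)))) < e / K * (r * \<bar>c\<bar> + r * s)"
      using d(2)[of "x0 + r * c" "r * s"] r by (simp add: abs_mult)
    also have "e / K * (r * \<bar>c\<bar> + r * s) = e / K * (r * K)"
      by (simp add: K_def algebra_simps)
    also have "\<dots> = e * r" using K by simp
    finally show "cmod (\<mu> (ball (x0 + r * c) (r * s)) -
        L * of_real (measure lborel (ball (x0 + r * c) (r * s)))) < e * r" .
  qed
qed

lemma has_strong_derivative_imp_has_sigma_derivative:
  assumes "locally_finite_measure \<mu>" and L: "has_strong_derivative \<mu> x0 L"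
  shows "has_sigma_derivative \<mu> x0 L"
  unfolding has_sigma_derivative_def
proof (intro allI impI)
  fix \<epsilon> :: real assume "0 < \<epsilon>"
  define \<nu> where "\<nu> A = \<mu> A - L * of_real (measure lborel A)" for A
  interpret bounded_countably_additive \<nu>
    unfolding \<nu>_def using assms(1) by (rule bounded_countably_additive_minus_lborel)
  \<comment> \<open>Any fraction below \<open>\<epsilon> / 5\<close> would do: the factor 5 of
    \<open>norm_ball_le\<close> must leave a strict inequality.\<close>
  define e where "e = \<epsilon> / 6"
  have e: "0 < e" using \<open>0 < \<epsilon>\<close> by (simp add: e_def)
  have ex: "\<exists>d>0. \<forall>r. 0 < r \<longrightarrow> r < d \<longrightarrow> cmod (\<nu> (ball (x0 + r * c) (r * s))) < e * r"
    if "0 < s" for c s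
    using L that e unfolding has_strong_derivative_iff \<nu>_def by blast
  obtain d1 where d1: "0 < d1"
      "\<And>r. 0 < r \<Longrightarrow> r < d1 \<Longrightarrow> cmod (\<nu> (ball (x0 + r * (1/2)) (r * (1/2)))) < e * r"
    using ex[of "1/2" "1/2"] by auto
  obtain d2 where d2: "0 < d2"
      "\<And>r. 0 < r \<Longrightarrow> r < d2 \<Longrightarrow> cmod (\<nu> (ball (x0 + r * (-1/2)) (r * (1/2)))) < e * r"
    using ex[of "1/2" "-1/2"] by auto
  obtain d3 where d3: "0 < d3"
      "\<And>r. 0 < r \<Longrightarrow> r < d3 \<Longrightarrow> cmod (\<nu> (ball (x0 + r * 0) (r * 1))) < e * r"
    using ex[of 1 0] by auto
  define d where "d = Min {d1, d2, d3}"
  have d: "0 < d" "d \<le> d1" "d \<le> d2" "d \<le> d3"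
    using d1 d2 d3 by (auto simp: d_def)
  have balls: "ball (x0 + t * (1/2)) (t * (1/2)) = {x0<..<x0 + t}"
    "ball (x0 + t * (-1/2)) (t * (1/2)) = {x0 - t<..<x0}"
    "ball (x0 + t * 0) (t * 1) = {x0 - t<..<x0 + t}" for t
    by (auto simp: ball_eq_greaterThanLessThan)
  show "\<exists>\<delta>>0. \<forall>x r. \<bar>x - x0\<bar> < \<delta> \<longrightarrow> 0 < r \<longrightarrow> r < \<delta> \<longrightarrow>
      cmod (\<mu> (ball x r) - L * of_real (measure lborel (ball x r))) < \<epsilon> * (\<bar>x - x0\<bar> + r)"
  \<comment> \<open>Halving gives \<open>\<bar>x - x0\<bar> + r < d\<close>, so the ball lies in the
    range of the three estimates.\<close>
  proof (intro exI[of _ "d / 2"] conjI allI impI)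
    show "0 < d / 2" using d by simp
    fix x r assume xr: "\<bar>x - x0\<bar> < d / 2" "0 < r" "r < d / 2"
    have "cmod (\<nu> (ball x r)) \<le> 5 * e * (\<bar>x - x0\<bar> + r)"
    proof (rule norm_ball_le[where d = d])
      fix t assume t: "0 < t" "t < d"
      show "cmod (\<nu> {x0<..<x0 + t}) \<le> e * t"
        using d1(2)[of t] t d unfolding balls by simp
      show "cmod (\<nu> {x0 - t<..<x0}) \<le> e * t"
        using d2(2)[of t] t d unfolding balls by simp
      show "cmod (\<nu> {x0 - t<..<x0 + t}) \<le> e * t"
        using d3(2)[of t] t d unfolding balls by simp
    qed (use xr e in auto)
    also have "\<dots> < \<epsilon> * (\<bar>x - x0\<bar> + r)"
      using \<open>0 < \<epsilon>\<close> xr by (intro mult_strict_right_mono) (auto simp: e_def)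
    finally show "cmod (\<mu> (ball x r) - L * of_real (measure lborel (ball x r)))
        < \<epsilon> * (\<bar>x - x0\<bar> + r)"
      by (simp add: \<nu>_def)
  qed
qed

theorem corollary3p5:
  fixes \<mu> :: "real set \<Rightarrow> complex" and x0 :: real
  assumes "locally_finite_measure \<mu>"
  shows "(sigma_point \<mu> x0 \<longleftrightarrow> strongly_differentiable \<mu> x0) \<and>
    (sigma_point \<mu> x0 \<longrightarrow> sigma_derivative \<mu> x0 = strong_derivative \<mu> x0)"
proof -
  \<comment> \<open>Equivalence for each fixed \<open>L\<close> settles existence and also
    identifies the two \<open>THE\<close> terms.\<close>
  have "has_sigma_derivative \<mu> x0 L \<longleftrightarrow> has_strong_derivative \<mu> x0 L" for L
    by (rule iffI[OF has_sigma_derivative_imp_has_strong_derivative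
          has_strong_derivative_imp_has_sigma_derivative[OF assms]])
  then show ?thesis
    by (simp add: sigma_point_def strongly_differentiable_def
        sigma_derivative_def strong_derivative_def)
qed

end
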